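(* Let $m\ge 2$ and let $\mathcal H_{m,1}\subseteq\mathbb C^m$ be the hypothesis variety of the class of $0$-spheres in $\mathbb C^1$, that is, of the polynomial $f_\beta(y)=(y-\beta_1)^2-\beta_0$ with $\beta=(\beta_0,\beta_1)\in\mathbb C^2$. Then $$\mathrm{EDdegree}(\mathcal H_{m,1})=2^{m-1}-1,$$ and if $p\in\mathbb R^m$ is a real configuration, then the critical points of $\mathcal H_{m,1}$ with respect to $p$ are all real.
   Context: The incidence variety is $C_{m,1}=\{(x,\beta)\in\mathbb C^m\times\mathbb C^2 \mid f_\beta(x_i)=0 \text{ for all } 1\le i\le m\}$, and the hypothesis variety $\mathcal H_{m,1}$ is the Zariski closure of the image of $C_{m,1}$ under the projection $\pi\colon\mathbb C^{m}\times\mathbb C^2\to\mathbb C^m$, $(x,\beta)\mapsto x$. For a variety $V\subseteq\mathbb C^N$ and $p\in\mathbb C^N$, a critical point of $V$ with respect to $p$ is a nonsingular point $q\in V$ such that $p-q$ lies in the normal space of $V$ at $q$, i.e. $p-q$ is orthogonal to the tangent space $T_qV$ with respect to the bilinear form $(u,v)\mapsto\sum_i u_iv_i$. These are the critical points on $V$ of the function $q\mapsto d_E(p,q)=\sum_i(p_i-q_i)^2$. $\mathrm{EDdegree}(V)$ is the number of critical points of $V$ with respect to a generic $p\in\mathbb C^N$. *)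

theory Defs
  imports
    "HOL-Analysis.Analysis"
    "HOL-Computational_Algebra.Polynomial"
    "HOL-Library.Extended_Nat"
begin

text \<open>Since the complex numbers are an infinite field, a polynomial in the coordinates is
  determined by the function it induces, so polynomials are represented by polynomial functions.
  (The predicate \<^const>\<open>real_polynomial_function\<close> of the library is based on real-linear
  forms and therefore not suitable: it would admit complex conjugation.)\<close>

inductive_set poly_funs :: "(complex ^ 'n \<Rightarrow> complex) set" where
  const: "(\<lambda>x. c) \<in> poly_funs"
| coord: "(\<lambda>x. x $ i) \<in> poly_funs"
| add: "f \<in> poly_funs \<Longrightarrow> g \<in> poly_funs \<Longrightarrow> (\<lambda>x. f x + g x) \<in> poly_funs"
| mult: "f \<in> poly_funs \<Longrightarrow> g \<in> poly_funs \<Longrightarrow> (\<lambda>x. f x * g x) \<in> poly_funs"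

definition zariski_closed :: "(complex ^ 'n) set \<Rightarrow> bool" where
  "zariski_closed V \<longleftrightarrow> (\<exists>S \<subseteq> poly_funs. V = {x. \<forall>f \<in> S. f x = 0})"

definition zariski_open :: "(complex ^ 'n) set \<Rightarrow> bool" where
  "zariski_open U \<longleftrightarrow> zariski_closed (- U)"

definition vanishing_ideal :: "(complex ^ 'n) set \<Rightarrow> (complex ^ 'n \<Rightarrow> complex) set" where
  "vanishing_ideal V = {f \<in> poly_funs. \<forall>x \<in> V. f x = 0}"

definition irreducible_variety :: "(complex ^ 'n) set \<Rightarrow> bool" where
  "irreducible_variety Z \<longleftrightarrow> zariski_closed Z \<and> Z \<noteq> {} \<and>
     (\<forall>A B. zariski_closed A \<longrightarrow> zariski_closed B \<longrightarrow> Z = A \<union> B \<longrightarrow> Z = A \<or> Z = B)"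

definition partial_deriv :: "'n \<Rightarrow> (complex ^ 'n \<Rightarrow> complex) \<Rightarrow> complex ^ 'n \<Rightarrow> complex" where
  "partial_deriv i f q = deriv (\<lambda>t. f (\<chi> j. if j = i then t else q $ j)) (q $ i)"

text \<open>The Zariski tangent space, as a linear subspace (not translated to \<open>q\<close>).\<close>

definition tangent_space :: "(complex ^ 'n) set \<Rightarrow> complex ^ 'n \<Rightarrow> (complex ^ 'n) set" where
  "tangent_space V q =
     {v. \<forall>f \<in> vanishing_ideal V. (\<Sum>i\<in>UNIV. partial_deriv i f q * v $ i) = 0}"

text \<open>The local dimension of \<open>V\<close> at \<open>q\<close> is the Krull dimension of the local ring of \<open>V\<close>
  at \<open>q\<close>: prime ideals of that ring correspond to irreducible closed subsets of \<open>V\<close>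
  containing \<open>q\<close>. It is the largest dimension of an irreducible component of \<open>V\<close> through \<open>q\<close>.\<close>

definition local_dim :: "(complex ^ 'n) set \<Rightarrow> complex ^ 'n \<Rightarrow> enat" where
  "local_dim V q =
     Sup {enat d | d. \<exists>Z. (\<forall>i\<le>d. irreducible_variety (Z i) \<and> q \<in> Z i \<and> Z i \<subseteq> V) \<and>
                          (\<forall>i<d. Z i \<subset> Z (Suc i))}"

text \<open>\<^const>\<open>vec.dim\<close> is the dimension over the complex numbers.\<close>

definition nonsingular_point :: "(complex ^ 'n) set \<Rightarrow> complex ^ 'n \<Rightarrow> bool" where
  "nonsingular_point V q \<longleftrightarrow> q \<in> V \<and> enat (vec.dim (tangent_space V q)) = local_dim V q"

text \<open>The complex bilinear form; neither the Hermitian form nor the real inner product of the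
  library.\<close>

definition bilin :: "complex ^ 'n \<Rightarrow> complex ^ 'n \<Rightarrow> complex" where
  "bilin u v = (\<Sum>i\<in>UNIV. u $ i * v $ i)"

definition critical_points :: "(complex ^ 'n) set \<Rightarrow> complex ^ 'n \<Rightarrow> (complex ^ 'n) set" where
  "critical_points V p =
     {q. nonsingular_point V q \<and> (\<forall>v \<in> tangent_space V q. bilin (p - q) v = 0)}"

definition has_ED_degree :: "(complex ^ 'n) set \<Rightarrow> nat \<Rightarrow> bool" where
  "has_ED_degree V d \<longleftrightarrow>
     (\<exists>U. zariski_open U \<and> U \<noteq> {} \<and>
          (\<forall>p \<in> U. finite (critical_points V p) \<and> card (critical_points V p) = d))"

definition ED_degree :: "(complex ^ 'n) set \<Rightarrow> nat" where
  "ED_degree V = (THE d. has_ED_degree V d)"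

text \<open>Any two nonempty Zariski open sets meet, so the generic number of critical points is
  unique.\<close>

lemma poly_funs_line:
  assumes "f \<in> poly_funs"
  shows "\<exists>P. \<forall>t. f (a + t *s v) = poly P t"
  using assms
proof induction
  case (const c)
  show ?case by (rule exI[of _ "[:c:]"]) simp
next
  case (coord i)
  show ?case by (rule exI[of _ "[:a $ i, v $ i:]"]) simp
next
  case (add f g)
  then obtain P Q where "\<forall>t. f (a + t *s v) = poly P t" "\<forall>t. g (a + t *s v) = poly Q t"
    by blast
  then show ?case by (intro exI[of _ "P + Q"]) simp
next
  case (mult f g)
  then obtain P Q where "\<forall>t. f (a + t *s v) = poly P t" "\<forall>t. g (a + t *s v) = poly Q t"
    by blast
  then show ?case by (intro exI[of _ "P * Q"]) simp
qed

lemma zariski_open_Int_nonempty: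
  assumes "zariski_open U" "U \<noteq> {}" "zariski_open W" "W \<noteq> {}"
  shows "U \<inter> W \<noteq> {}"
proof -
  obtain S T where S: "S \<subseteq> poly_funs" "- U = {x. \<forall>f \<in> S. f x = 0}"
    and T: "T \<subseteq> poly_funs" "- W = {x. \<forall>f \<in> T. f x = 0}"
    using assms unfolding zariski_open_def zariski_closed_def by (elim exE conjE) blast
  obtain a b where "a \<in> U" "b \<in> W" using assms by blast
  then obtain f g where f: "f \<in> S" "f a \<noteq> 0" and g: "g \<in> T" "g b \<noteq> 0"
    using S(2) T(2) by blast
  obtain P where P: "\<And>t. f (a + t *s (b - a)) = poly P t"
    using poly_funs_line[of f a "b - a"] f(1) S(1) by blast
  obtain Q where Q: "\<And>t. g (a + t *s (b - a)) = poly Q t"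
    using poly_funs_line[of g a "b - a"] g(1) T(1) by blast
  have "P \<noteq> 0" using P[of 0] f(2) by auto
  moreover have "Q \<noteq> 0" using Q[of 1] g(2) by auto
  ultimately have "finite {t. poly (P * Q) t = 0}"
    by (intro poly_roots_finite) simp
  then have "{t. poly (P * Q) t = 0} \<noteq> UNIV"
    using infinite_UNIV_char_0[where 'a = complex] by metis
  then obtain t where "poly (P * Q) t \<noteq> 0"
    by blast
  then have "f (a + t *s (b - a)) \<noteq> 0" "g (a + t *s (b - a)) \<noteq> 0"
    using P Q by auto
  then have "a + t *s (b - a) \<in> U \<inter> W"
    using f(1) g(1) S(2) T(2) by blast
  then show ?thesis by blast
qed

lemma ED_degree_eqI:
  assumes "has_ED_degree V d"
  shows "ED_degree V = d"
  unfolding ED_degree_def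
proof (rule the_equality)
  show "has_ED_degree V d" by fact
  fix e assume "has_ED_degree V e"
  then obtain U W where "zariski_open U" "U \<noteq> {}" "\<forall>p \<in> U. card (critical_points V p) = d"
    "zariski_open W" "W \<noteq> {}" "\<forall>p \<in> W. card (critical_points V p) = e"
    using assms unfolding has_ED_degree_def by blast
  then show "e = d" using zariski_open_Int_nonempty[of U W] by fastforce
qed

text \<open>Here \<open>\<beta> = (\<beta>\<^sub>0, \<beta>\<^sub>1)\<close>.\<close>

definition sphere0 :: "complex \<times> complex \<Rightarrow> complex \<Rightarrow> complex" where
  "sphere0 = (\<lambda>(\<beta>\<^sub>0, \<beta>\<^sub>1) y. (y - \<beta>\<^sub>1)\<^sup>2 - \<beta>\<^sub>0)"

definition incidence_variety :: "((complex ^ 'm) \<times> (complex \<times> complex)) set" where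
  "incidence_variety = {(x, \<beta>). \<forall>i. sphere0 \<beta> (x $ i) = 0}"

definition hypothesis_variety :: "(complex ^ 'm) set" where
  "hypothesis_variety = zariski_closed hull (fst ` incidence_variety)"

end

theory Submission imports Defs begin

text \<open>The coordinates of \<open>x\<close> lie on a common \<open>0\<close>-sphere, that is, all \<open>x\<^sub>i\<close> are roots of one monic
  quadratic polynomial, if and only if \<open>x\<close> has at most two distinct coordinates. This is expressed by the
  equations \<open>(x\<^sub>i - x\<^sub>j) (x\<^sub>j - x\<^sub>k) (x\<^sub>i - x\<^sub>k) = 0\<close>, so the image of the incidence variety is
  already closed, and the hypothesis variety is a union of planes, one for each partition of the
  \<open>m\<close> coordinates into two nonempty blocks \<open>T\<close> and \<open>- T\<close>: the plane consists of the vectors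
  that are constant on both blocks. There are \<open>2 ^ (m - 1) - 1\<close> such partitions. Two different
  planes meet only in the line of constant vectors.

  The tangent space at a point of a plane contains that plane. Hence if \<open>q\<close> is critical for \<open>p\<close>
  and lies in the plane of \<open>T\<close>, then \<open>q\<close> is the orthogonal projection of \<open>p\<close> to it: on each
  block, \<open>q\<close> takes the mean of \<open>p\<close> over the block (\<open>critical_point_block_means\<close>). Means of real
  numbers are real, which is the second claim. Conversely, if the two means differ, then the
  projection is not a constant vector, the hypothesis variety has no other plane through it, and
  it is a critical point (\<open>block_means_critical_point\<close>). For generic \<open>p\<close> the two means differ
  for every partition, and the projection then determines the partition; so the critical points
  are in bijection with the partitions.

  Nonsingularity at a nonconstant point needs that the local dimension, a supremum of lengths of
  chains of irreducible varieties, equals \<open>2\<close>. The work is in the upper bound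
  \<open>no_long_chain_in_plane\<close>. Its proof uses the characterisation of Krull dimension by algebraic
  relations: along a chain \<open>Z\<^sub>0 \<subset> Z\<^sub>1 \<subset> Z\<^sub>2 \<subset> Z\<^sub>3\<close>, choose \<open>f\<^sub>i\<close> that vanishes on \<open>Z\<^sub>i\<close> but not on
  \<open>Z\<^sub>i\<^sub>+\<^sub>1\<close>. Counting dimensions gives a nontrivial relation between \<open>f\<^sub>0\<close>, \<open>f\<^sub>1\<close>, \<open>f\<^sub>2\<close> on the
  plane. Cancelling powers of \<open>f\<^sub>2\<close> on \<open>Z\<^sub>3\<close> and restricting to \<open>Z\<^sub>2\<close>, then doing the same with
  \<open>f\<^sub>1\<close> and \<open>f\<^sub>0\<close>, shows that all its coefficients vanish.\<close>

section \<open>Polynomial functions and their degree along lines\<close>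

lemma poly_funs_diff:
  assumes "f \<in> poly_funs" "g \<in> poly_funs"
  shows "(\<lambda>x. f x - g x) \<in> poly_funs"
  using poly_funs.add[OF assms(1) poly_funs.mult[OF poly_funs.const[of "- 1"] assms(2)]]
  by simp

lemma poly_funs_sum:
  assumes "\<And>a. a \<in> A \<Longrightarrow> f a \<in> poly_funs"
  shows "(\<lambda>x. \<Sum>a\<in>A. f a x) \<in> poly_funs"
  using assms
  by (induction A rule: infinite_finite_induct) (auto intro: poly_funs.const poly_funs.add)

lemma poly_funs_prod:
  assumes "\<And>a. a \<in> A \<Longrightarrow> f a \<in> poly_funs"
  shows "(\<lambda>x. \<Prod>a\<in>A. f a x) \<in> poly_funs"
  using assms
  by (induction A rule: infinite_finite_induct) (auto intro: poly_funs.const poly_funs.mult)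

lemma poly_funs_power:
  assumes "f \<in> poly_funs"
  shows "(\<lambda>x. f x ^ k) \<in> poly_funs"
  using assms by (induction k) (auto intro: poly_funs.const poly_funs.mult)

text \<open>The degree of a multivariate polynomial is not visible in the function directly. Bounding the
  degrees of its restrictions to lines is enough to control its zeros, and these bounds add up
  under multiplication.\<close>

definition line_degree_le :: "nat \<Rightarrow> (complex ^ 'n \<Rightarrow> complex) \<Rightarrow> bool" where
  "line_degree_le n f \<longleftrightarrow>
     (\<forall>a v. \<exists>P. degree P \<le> n \<and> (\<forall>t. f (a + t *s v) = poly P t))"

lemma line_degree_le_const: "line_degree_le n (\<lambda>x. c)"
  unfolding line_degree_le_def by (intro allI exI[of _ "[:c:]"]) simp

lemma line_degree_le_add:
  assumes "line_degree_le n f" "line_degree_le n g"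
  shows "line_degree_le n (\<lambda>x. f x + g x)"
  unfolding line_degree_le_def
proof (intro allI)
  fix a v
  obtain P Q where "degree P \<le> n" "\<forall>t. f (a + t *s v) = poly P t"
    "degree Q \<le> n" "\<forall>t. g (a + t *s v) = poly Q t"
    using assms unfolding line_degree_le_def by meson
  then show "\<exists>R. degree R \<le> n \<and> (\<forall>t. f (a + t *s v) + g (a + t *s v) = poly R t)"
    by (intro exI[of _ "P + Q"]) (auto intro: degree_add_le)
qed

lemma line_degree_le_mult:
  assumes "line_degree_le n f" "line_degree_le k g"
  shows "line_degree_le (n + k) (\<lambda>x. f x * g x)"
  unfolding line_degree_le_def
proof (intro allI)
  fix a v
  obtain P Q where "degree P \<le> n" "\<forall>t. f (a + t *s v) = poly P t"
    "degree Q \<le> k" "\<forall>t. g (a + t *s v) = poly Q t"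
    using assms unfolding line_degree_le_def by meson
  then show "\<exists>R. degree R \<le> n + k \<and> (\<forall>t. f (a + t *s v) * g (a + t *s v) = poly R t)"
    by (intro exI[of _ "P * Q"]) (auto intro: order.trans[OF degree_mult_le])
qed

lemma line_degree_le_mono: "line_degree_le n f \<Longrightarrow> n \<le> k \<Longrightarrow> line_degree_le k f"
  unfolding line_degree_le_def by (meson order.trans)

lemma line_degree_le_power:
  assumes "line_degree_le n f"
  shows "line_degree_le (k * n) (\<lambda>x. f x ^ k)"
proof (induction k)
  case 0
  show ?case by (simp add: line_degree_le_const)
next
  case (Suc k)
  show ?case using line_degree_le_mult[OF assms Suc] by simp
qed

lemma line_degree_le_sum:
  assumes "\<And>a. a \<in> A \<Longrightarrow> line_degree_le n (f a)"
  shows "line_degree_le n (\<lambda>x. \<Sum>a\<in>A. f a x)"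
  using assms
  by (induction A rule: infinite_finite_induct)
    (auto intro: line_degree_le_const line_degree_le_add)

lemma poly_funs_line_degree:
  assumes "f \<in> poly_funs"
  shows "\<exists>n. line_degree_le n f"
  using assms
proof induction
  case (const c)
  show ?case using line_degree_le_const by blast
next
  case (coord i)
  have "line_degree_le 1 (\<lambda>x. x $ i)"
    unfolding line_degree_le_def
  proof (intro allI)
    fix a v :: "complex ^ 'a"
    show "\<exists>P. degree P \<le> 1 \<and> (\<forall>t. (a + t *s v) $ i = poly P t)"
      by (rule exI[of _ "[:a $ i, v $ i:]"]) simp
  qed
  then show ?case ..
next
  case (add f g)
  then obtain n k where "line_degree_le n f" "line_degree_le k g" by blast
  then have "line_degree_le (n + k) (\<lambda>x. f x + g x)"
    by (intro line_degree_le_add) (auto elim: line_degree_le_mono)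
  then show ?case ..
next
  case (mult f g)
  then show ?case using line_degree_le_mult by blast
qed

lemma poly_zero_if_zero_on_initial_nats:
  fixes P :: "complex poly"
  assumes "degree P \<le> n" "\<And>s. s \<le> n \<Longrightarrow> poly P (of_nat s) = 0"
  shows "P = 0"
proof (rule ccontr)
  assume P: "P \<noteq> 0"
  have "Suc n = card (of_nat ` {..n} :: complex set)"
    by (subst card_image) (auto simp: inj_on_def)
  also have "\<dots> \<le> card {x. poly P x = 0}"
    using assms(2) by (intro card_mono poly_roots_finite P) auto
  also have "\<dots> \<le> degree P" by (rule card_poly_roots_bound[OF P])
  finally show False using assms(1) by simp
qed

text \<open>A univariate polynomial of degree at most \<open>n\<close> with \<open>n + 1\<close> roots is zero. Applied to the rows
  of the grid and then to each line across the rows, this replaces a comparison of the coefficients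
  of a bivariate polynomial by finitely many evaluations.\<close>

lemma zero_on_plane_if_zero_on_grid:
  assumes deg: "line_degree_le n f"
    and grid: "\<And>s t. s \<le> n \<Longrightarrow> t \<le> n \<Longrightarrow> f (of_nat s *s u + of_nat t *s v) = 0"
  shows "f (s *s u + t *s v) = 0"
proof -
  have rows: "f (z *s u + of_nat k *s v) = 0" if k: "k \<le> n" for z k
  proof -
    obtain P where P: "degree P \<le> n" "\<And>t. f (of_nat k *s v + t *s u) = poly P t"
      using deg unfolding line_degree_le_def by meson
    have "P = 0"
      using P grid[OF _ k]
      by (intro poly_zero_if_zero_on_initial_nats[of P n]) (simp_all add: add.commute)
    then show ?thesis using P(2)[of z] by (simp add: add.commute)
  qed
  obtain Q where Q: "degree Q \<le> n" "\<And>t. f (s *s u + t *s v) = poly Q t"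
    using deg unfolding line_degree_le_def by meson
  have "Q = 0"
    using Q rows by (intro poly_zero_if_zero_on_initial_nats[of Q n]) metis+
  then show ?thesis using Q(2) by simp
qed

section \<open>Three polynomials on a plane are algebraically dependent\<close>

text \<open>Gaussian elimination: a pivot for the equation \<open>b\<close> removes one unknown and one equation.\<close>

lemma underdetermined_system_nontrivial_solution:
  fixes M :: "'a \<Rightarrow> 'b \<Rightarrow> 'c :: field"
  assumes "finite B" "finite A" "card B < card A"
  shows "\<exists>c. (\<exists>a\<in>A. c a \<noteq> 0) \<and> (\<forall>b\<in>B. (\<Sum>a\<in>A. c a * M a b) = 0)"
  using assms
proof (induction B arbitrary: A M rule: finite_induct)
  case empty
  then obtain a where "a \<in> A" by fastforce
  then show ?case by (intro exI[of _ "\<lambda>_. 1"]) auto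
next
  case (insert b B)
  show ?case
  proof (cases "\<forall>a\<in>A. M a b = 0")
    case True
    have "card B < card A" using insert by simp
    from insert.IH[OF insert.prems(1) this] obtain c where
      "\<exists>a\<in>A. c a \<noteq> 0" "\<forall>b\<in>B. (\<Sum>a\<in>A. c a * M a b) = 0" by blast
    then show ?thesis using True by (intro exI[of _ c]) auto
  next
    case False
    then obtain a0 where a0: "a0 \<in> A" "M a0 b \<noteq> 0" by blast
    define M' where "M' a y = M a y - M a b / M a0 b * M a0 y" for a y
    have "card B < card (A - {a0})"
      using insert a0 by simp
    from insert.IH[OF _ this, of M'] insert.prems(1) obtain c where
      c: "\<exists>a\<in>A - {a0}. c a \<noteq> 0" "\<forall>y\<in>B. (\<Sum>a\<in>A - {a0}. c a * M' a y) = 0" by blast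
    define r where "r = (\<Sum>a\<in>A - {a0}. c a * M a b)"
    define d where "d a = (if a = a0 then - r / M a0 b else c a)" for a
    have split: "(\<Sum>a\<in>A. d a * M a y) = - r / M a0 b * M a0 y + (\<Sum>a\<in>A - {a0}. c a * M a y)"
      for y
      using insert.prems(1) a0(1)
      by (subst sum.remove[of A a0]) (auto simp: d_def intro!: sum.cong)
    have "(\<Sum>a\<in>A. d a * M a y) = 0" if "y \<in> insert b B" for y
    proof (cases "y = b")
      case True
      then show ?thesis using a0(2) by (simp add: split r_def)
    next
      case False
      then have "(\<Sum>a\<in>A - {a0}. c a * M' a y) = 0" using that c(2) by blast
      moreover have "(\<Sum>a\<in>A - {a0}. c a * M' a y)
        = (\<Sum>a\<in>A - {a0}. c a * M a y) - (\<Sum>a\<in>A - {a0}. c a * M a b) / M a0 b * M a0 y"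
        by (simp add: M'_def algebra_simps sum_subtractf sum_distrib_left sum_distrib_right
            sum_divide_distrib)
      ultimately show ?thesis by (simp add: split r_def)
    qed
    moreover have "\<exists>a\<in>A. d a \<noteq> 0" using c(1) by (auto simp: d_def)
    ultimately show ?thesis by blast
  qed
qed

text \<open>There are \<open>N\<^sup>3\<close> monomials in three functions with exponents below \<open>N\<close>, while the vanishing of a
  combination of them on the plane is only \<open>O(N\<^sup>2)\<close> linear conditions on the coefficients, namely
  the vanishing on a grid whose size is linear in \<open>N\<close>. The nested form of the sum exhibits it as a
  polynomial in \<open>h\<close>, whose coefficients are polynomials in \<open>g\<close>, and so on.\<close>

lemma three_poly_funs_dependent_on_plane:
  fixes f g h :: "complex ^ 'n \<Rightarrow> complex"
  assumes "f \<in> poly_funs" "g \<in> poly_funs" "h \<in> poly_funs"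
  shows "\<exists>N c. (\<exists>i<N. \<exists>j<N. \<exists>k<N. c i j k \<noteq> 0) \<and>
    (\<forall>s t. let x = s *s u + t *s v in
       (\<Sum>k<N. (\<Sum>j<N. (\<Sum>i<N. c i j k * f x ^ i) * g x ^ j) * h x ^ k) = 0)"
proof -
  obtain a b d where abd: "line_degree_le a f" "line_degree_le b g" "line_degree_le d h"
    using assms poly_funs_line_degree by metis
  define D where "D = a + b + d"
  \<comment> \<open>The number of grid points is at most \<open>(N (D + 1))\<^sup>2\<close>, and this choice makes it less than
    \<open>N\<^sup>3\<close>.\<close>
  define N where "N = (D + 1)\<^sup>2 + 1"
  define n where "n = N * D"
  define A where "A = {..<N} \<times> {..<N} \<times> {..<N}"
  define B where "B = {..n} \<times> {..n}"
  define M where "M = (\<lambda>(k, j, i) (s, t).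
    let x = (of_nat s :: complex) *s u + of_nat t *s v in f x ^ i * g x ^ j * h x ^ k)"
  have "1 \<le> N" by (simp add: N_def)
  then have "n + 1 \<le> N * (D + 1)" by (simp add: n_def)
  from mult_le_mono[OF this this]
  have "(n + 1) * (n + 1) \<le> (N * (D + 1)) * (N * (D + 1))" .
  also have "\<dots> = N * N * (D + 1)\<^sup>2" by (simp add: power2_eq_square algebra_simps)
  also have "\<dots> < N * N * N" by (simp add: N_def)
  finally have "card B < card A" by (simp add: A_def B_def)
  moreover have "finite A" "finite B" by (auto simp: A_def B_def)
  ultimately obtain c where c: "\<exists>z\<in>A. c z \<noteq> 0" "\<forall>w\<in>B. (\<Sum>z\<in>A. c z * M z w) = 0"
    using underdetermined_system_nontrivial_solution[of B A M] by blast
  define F where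
    "F x = (\<Sum>k<N. (\<Sum>j<N. (\<Sum>i<N. c (k, j, i) * f x ^ i) * g x ^ j) * h x ^ k)" for x
  have F: "F x = (\<Sum>(k, j, i)\<in>A. c (k, j, i) * (f x ^ i * g x ^ j * h x ^ k))" for x
  proof -
    have "F x = (\<Sum>k<N. \<Sum>j<N. \<Sum>i<N. c (k, j, i) * (f x ^ i * g x ^ j * h x ^ k))"
      by (simp add: F_def sum_distrib_right mult.assoc)
    then show ?thesis by (simp add: A_def sum.cartesian_product case_prod_unfold)
  qed
  have "line_degree_le n F"
  proof -
    have "line_degree_le n (\<lambda>x. c (k, j, i) * (f x ^ i * g x ^ j * h x ^ k))"
      if "(k, j, i) \<in> A" for i j k
    proof -
      have "i * a + j * b + k * d \<le> N * a + N * b + N * d"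
        using that by (intro add_mono mult_right_mono) (auto simp: A_def)
      then have "0 + (i * a + j * b + k * d) \<le> n" by (simp add: n_def D_def algebra_simps)
      then show ?thesis
        by (rule line_degree_le_mono[rotated])
          (intro line_degree_le_mult line_degree_le_const line_degree_le_power abd)
    qed
    then have "line_degree_le n
        (\<lambda>x. \<Sum>z\<in>A. case z of (k, j, i) \<Rightarrow> c (k, j, i) * (f x ^ i * g x ^ j * h x ^ k))"
      by (intro line_degree_le_sum) auto
    then show ?thesis using F by presburger
  qed
  moreover have "F (of_nat s *s u + of_nat t *s v) = 0" if "s \<le> n" "t \<le> n" for s t
  proof -
    have "(\<Sum>z\<in>A. c z * M z (s, t)) = 0" using c(2) that by (simp add: B_def)
    then show ?thesis by (simp add: F M_def Let_def case_prod_unfold)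
  qed
  ultimately have "F (s *s u + t *s v) = 0" for s t
    by (rule zero_on_plane_if_zero_on_grid)
  moreover have "\<exists>i<N. \<exists>j<N. \<exists>k<N. c (k, j, i) \<noteq> 0" using c(1) by (auto simp: A_def)
  ultimately show ?thesis
    by (intro exI[of _ N] exI[of _ "\<lambda>i j k. c (k, j, i)"]) (simp add: F_def Let_def)
qed

section \<open>Irreducible varieties and the dimension of a plane\<close>

lemma zariski_closed_Int_zeros:
  assumes "zariski_closed Z" "f \<in> poly_funs"
  shows "zariski_closed {x \<in> Z. f x = 0}"
proof -
  obtain S where "S \<subseteq> poly_funs" "Z = {x. \<forall>f \<in> S. f x = 0}"
    using assms(1) unfolding zariski_closed_def by blast
  then show ?thesis
    unfolding zariski_closed_def using assms(2) by (intro exI[of _ "insert f S"]) auto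
qed

text \<open>The vanishing ideal of an irreducible variety is prime, since otherwise the zeros of \<open>f\<close> and of
  \<open>g\<close> would decompose \<open>Z\<close>.\<close>

lemma irreducible_variety_prime:
  assumes Z: "irreducible_variety Z" and "f \<in> poly_funs" "g \<in> poly_funs"
    and fg: "\<And>x. x \<in> Z \<Longrightarrow> f x * g x = 0"
  shows "(\<forall>x\<in>Z. f x = 0) \<or> (\<forall>x\<in>Z. g x = 0)"
proof -
  have "zariski_closed Z" using Z by (simp add: irreducible_variety_def)
  then have "zariski_closed {x \<in> Z. f x = 0}" "zariski_closed {x \<in> Z. g x = 0}"
    using assms(2,3) by (auto intro: zariski_closed_Int_zeros)
  moreover have "Z = {x \<in> Z. f x = 0} \<union> {x \<in> Z. g x = 0}" using fg by auto
  ultimately have "Z = {x \<in> Z. f x = 0} \<or> Z = {x \<in> Z. g x = 0}"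
    using Z unfolding irreducible_variety_def by blast
  then show ?thesis by blast
qed

lemma separating_poly_fun:
  assumes "zariski_closed W" "z \<notin> W"
  obtains f where "f \<in> poly_funs" "\<And>x. x \<in> W \<Longrightarrow> f x = 0" "f z \<noteq> 0"
  using assms unfolding zariski_closed_def by blast

text \<open>A proper decomposition would give two polynomials, neither zero on \<open>Z\<close>, with product zero on
  \<open>Z\<close>. On the line through a nonzero of each they are nonzero univariate polynomials, whose product
  is not zero.\<close>

lemma irreducible_variety_if_contains_lines:
  assumes Z: "zariski_closed Z" "Z \<noteq> {}"
    and lines: "\<And>x y t. x \<in> Z \<Longrightarrow> y \<in> Z \<Longrightarrow> x + t *s (y - x) \<in> Z"
  shows "irreducible_variety Z"
  unfolding irreducible_variety_def
proof (intro conjI Z allI impI)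
  fix A B assume A: "zariski_closed A" and B: "zariski_closed B" and AB: "Z = A \<union> B"
  show "Z = A \<or> Z = B"
  proof (rule ccontr)
    assume "\<not> ?thesis"
    then obtain x y where xy: "x \<in> Z" "x \<notin> A" "y \<in> Z" "y \<notin> B" using AB by blast
    obtain f where f: "f \<in> poly_funs" "\<And>x. x \<in> A \<Longrightarrow> f x = 0" "f x \<noteq> 0"
      using separating_poly_fun[OF A xy(2)] by blast
    obtain g where g: "g \<in> poly_funs" "\<And>x. x \<in> B \<Longrightarrow> g x = 0" "g y \<noteq> 0"
      using separating_poly_fun[OF B xy(4)] by blast
    obtain P where P: "\<And>t. f (x + t *s (y - x)) = poly P t"
      using poly_funs_line[OF f(1)] by blast
    obtain Q where Q: "\<And>t. g (x + t *s (y - x)) = poly Q t"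
      using poly_funs_line[OF g(1)] by blast
    have "poly (P * Q) t = 0" for t
      using lines[OF xy(1,3), of t] AB f(2) g(2) P[of t] Q[of t] by force
    then have "P * Q = 0" using poly_all_0_iff_0 by blast
    moreover have "poly P 0 \<noteq> 0" using P[of 0] f(3) by simp
    moreover have "poly Q 1 \<noteq> 0" using Q[of 1] g(3) by simp
    ultimately show False by auto
  qed
qed

text \<open>The lowest coefficient of a polynomial relation for \<open>f\<close> on \<open>Z\<close> vanishes where \<open>f\<close> does: as \<open>f\<close>
  is not zero on the irreducible \<open>Z\<close>, the power of \<open>f\<close> common to all terms can be cancelled. The
  hypothesis \<open>lift\<close> makes it possible to go on with the next coefficient. In the application the \<open>g k\<close>
  are polynomial expressions in functions that are algebraically independent on \<open>W\<close>, so that \<open>g k\<close>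
  vanishes on \<open>W\<close> only if its own coefficients are zero.\<close>

lemma coefficients_vanish_on_subvariety:
  assumes Z: "irreducible_variety Z" and WZ: "W \<subseteq> Z"
    and f: "f \<in> poly_funs" "\<And>x. x \<in> W \<Longrightarrow> f x = 0" "z \<in> Z" "f z \<noteq> 0"
    and g: "\<And>k. k < N \<Longrightarrow> g k \<in> poly_funs"
    and relation: "\<And>x. x \<in> Z \<Longrightarrow> (\<Sum>k<N. g k x * f x ^ k) = 0"
    and lift: "\<And>k. k < N \<Longrightarrow> (\<And>x. x \<in> W \<Longrightarrow> g k x = 0) \<Longrightarrow> (\<And>x. x \<in> Z \<Longrightarrow> g k x = 0)"
    and k: "k < N" and x: "x \<in> W"
  shows "g k x = 0"
  using k x
proof (induction k arbitrary: x rule: less_induct)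
  case (less k)
  \<comment> \<open>The relation divided by \<open>f\<^sup>k\<close>, without the terms that are already known to vanish on \<open>Z\<close>.\<close>
  define r where "r y = g k y + f y * (\<Sum>j\<in>{Suc k..<N}. g j y * f y ^ (j - Suc k))" for y
  have r: "r \<in> poly_funs"
    unfolding r_def using g less.prems(1)
    by (intro poly_funs.add poly_funs.mult poly_funs_sum poly_funs_power f(1)) auto
  have "f y ^ k * r y = 0" if y: "y \<in> Z" for y
  proof -
    have "(\<Sum>j<N. g j y * f y ^ j)
      = (\<Sum>j\<in>{..<k}. g j y * f y ^ j) + (\<Sum>j\<in>{k..<N}. g j y * f y ^ j)"
      using less.prems(1) by (subst sum.union_disjoint[symmetric]) (auto intro!: sum.cong)
    moreover have "(\<Sum>j\<in>{..<k}. g j y * f y ^ j) = 0"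
    proof (rule sum.neutral, rule ballI)
      fix j assume "j \<in> {..<k}"
      then have j: "j < k" "j < N" using less.prems(1) by auto
      then show "g j y * f y ^ j = 0"
        using lift[OF j(2) _ y] less.IH[OF j] by simp
    qed
    moreover have "(\<Sum>j\<in>{k..<N}. g j y * f y ^ j)
      = g k y * f y ^ k + (\<Sum>j\<in>{Suc k..<N}. g j y * f y ^ j)"
      using less.prems(1) by (rule sum.atLeast_Suc_lessThan)
    moreover have "(\<Sum>j\<in>{Suc k..<N}. g j y * f y ^ j)
      = f y ^ k * (f y * (\<Sum>j\<in>{Suc k..<N}. g j y * f y ^ (j - Suc k)))"
      unfolding sum_distrib_left
    proof (rule sum.cong[OF refl])
      fix j assume "j \<in> {Suc k..<N}"
      then have "f y ^ j = f y ^ k * (f y * f y ^ (j - Suc k))"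
        by (simp flip: power_Suc power_add)
      then show "g j y * f y ^ j = f y ^ k * (f y * (g j y * f y ^ (j - Suc k)))"
        by simp
    qed
    ultimately show ?thesis using relation[OF y] by (simp add: r_def algebra_simps)
  qed
  then have "(\<forall>y\<in>Z. f y ^ k = 0) \<or> (\<forall>y\<in>Z. r y = 0)"
    by (intro irreducible_variety_prime[OF Z] poly_funs_power f(1) r) blast
  then have "r x = 0" using f(3,4) less.prems(2) WZ by auto
  then show ?case using f(2)[OF less.prems(2)] by (simp add: r_def)
qed

text \<open>A plane has Krull dimension at most \<open>2\<close>. The functions \<open>f 0\<close>, \<open>f 1\<close>, \<open>f 2\<close> below vanish on
  \<open>Z 0\<close>, \<open>Z 1\<close>, \<open>Z 2\<close> but not on the next variety. Then \<open>f 0\<close> is algebraically independent on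
  \<open>Z 1\<close>, \<open>f 0\<close> and \<open>f 1\<close> are so on \<open>Z 2\<close>, and all three on \<open>Z 3\<close>, which contradicts their
  dependence on the plane.\<close>

lemma no_long_chain_in_plane:
  fixes Z :: "nat \<Rightarrow> (complex ^ 'n) set"
  assumes irr: "\<And>i. i \<le> 3 \<Longrightarrow> irreducible_variety (Z i)"
    and chain: "\<And>i. i < 3 \<Longrightarrow> Z i \<subset> Z (Suc i)"
    and plane: "Z 3 \<subseteq> {s *s u + t *s v | s t. True}"
  shows False
proof -
  have "\<exists>f z. f \<in> poly_funs \<and> (\<forall>x\<in>Z i. f x = 0) \<and> z \<in> Z (Suc i) \<and> f z \<noteq> 0" if "i < 3" for i
  proof -
    obtain z where "z \<in> Z (Suc i)" "z \<notin> Z i" using chain[OF \<open>i < 3\<close>] by blast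
    moreover have "zariski_closed (Z i)" using irr[of i] that by (simp add: irreducible_variety_def)
    ultimately show ?thesis by (meson separating_poly_fun)
  qed
  then obtain f z where f: "\<And>i. i < 3 \<Longrightarrow> f i \<in> poly_funs"
    "\<And>i x. i < 3 \<Longrightarrow> x \<in> Z i \<Longrightarrow> f i x = 0"
    "\<And>i. i < 3 \<Longrightarrow> z i \<in> Z (Suc i)" "\<And>i. i < 3 \<Longrightarrow> f i (z i) \<noteq> 0" by metis
  obtain N c where c: "\<exists>i<N. \<exists>j<N. \<exists>k<N. c i j k \<noteq> 0" and rel: "\<And>s t. let x = s *s u + t *s v in
       (\<Sum>k<N. (\<Sum>j<N. (\<Sum>i<N. c i j k * f 0 x ^ i) * f 1 x ^ j) * f 2 x ^ k) = 0"
    using three_poly_funs_dependent_on_plane[OF f(1)[of 0] f(1)[of 1] f(1)[of 2], of u v]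
    by (simp del: One_nat_def) blast
  have rel: "(\<Sum>k<N. (\<Sum>j<N. (\<Sum>i<N. c i j k * f 0 x ^ i) * f 1 x ^ j) * f 2 x ^ k) = 0"
    if "x \<in> Z 3" for x
    using that rel plane by (auto simp: Let_def)
  have chain': "Z 0 \<subseteq> Z 1" "Z 1 \<subseteq> Z 2" "Z 2 \<subseteq> Z 3"
    using chain[of 0] chain[of 1] chain[of 2] by (auto simp: numeral_eq_Suc)
  have mem: "z 0 \<in> Z 1" "z 1 \<in> Z 2" "z 2 \<in> Z 3"
    using f(3)[of 0] f(3)[of 1] f(3)[of 2] by (auto simp: numeral_eq_Suc)
  have indep0: "a i = 0"
    if "\<And>x. x \<in> Z 1 \<Longrightarrow> (\<Sum>i<N. a i * f 0 x ^ i) = 0" "i < N" for a i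
  proof -
    obtain w where "w \<in> Z 0" using irr[of 0] by (auto simp: irreducible_variety_def)
    then show ?thesis
      using that irr[of 1] chain' mem f(1,2,4) poly_funs.const
      by (intro coefficients_vanish_on_subvariety[of "Z 1" "Z 0" "f 0" "z 0" N "\<lambda>i x. a i" i w]) auto
  qed
  have indep1: "a i j = 0"
    if "\<And>x. x \<in> Z 2 \<Longrightarrow> (\<Sum>j<N. (\<Sum>i<N. a i j * f 0 x ^ i) * f 1 x ^ j) = 0" "i < N" "j < N"
    for a i j
  proof -
    have "(\<Sum>i<N. a i j * f 0 x ^ i) = 0" if "x \<in> Z 1" for x
    proof (rule coefficients_vanish_on_subvariety[of "Z 2" "Z 1" "f 1" "z 1" N
          "\<lambda>j x. \<Sum>i<N. a i j * f 0 x ^ i" j x])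
      fix k x assume "\<And>x. x \<in> Z 1 \<Longrightarrow> (\<Sum>i<N. a i k * f 0 x ^ i) = 0"
      then have "a i k = 0" if "i < N" for i using indep0[of "\<lambda>i. a i k"] that by blast
      then show "(\<Sum>i<N. a i k * f 0 x ^ i) = 0" by simp
    qed (use \<open>j < N\<close> \<open>x \<in> Z 1\<close> \<open>\<And>x. x \<in> Z 2 \<Longrightarrow> _\<close> irr[of 2] chain' mem f(1,2,4) in
        \<open>auto intro!: poly_funs_sum poly_funs.mult poly_funs.const poly_funs_power\<close>)
    then show ?thesis using indep0[of "\<lambda>i. a i j"] \<open>i < N\<close> by blast
  qed
  have "c i j k = 0" if "i < N" "j < N" "k < N" for i j k
  proof -
    have "(\<Sum>j<N. (\<Sum>i<N. c i j k * f 0 x ^ i) * f 1 x ^ j) = 0" if "x \<in> Z 2" for x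
    proof (rule coefficients_vanish_on_subvariety[of "Z 3" "Z 2" "f 2" "z 2" N
          "\<lambda>k x. \<Sum>j<N. (\<Sum>i<N. c i j k * f 0 x ^ i) * f 1 x ^ j" k x])
      fix k x assume "\<And>x. x \<in> Z 2 \<Longrightarrow> (\<Sum>j<N. (\<Sum>i<N. c i j k * f 0 x ^ i) * f 1 x ^ j) = 0"
      then have "c i j k = 0" if "i < N" "j < N" for i j
        using indep1[of "\<lambda>i j. c i j k"] that by blast
      then show "(\<Sum>j<N. (\<Sum>i<N. c i j k * f 0 x ^ i) * f 1 x ^ j) = 0" by simp
    qed (use \<open>k < N\<close> \<open>x \<in> Z 2\<close> rel irr[of 3] chain' mem f(1,2,4) in
        \<open>auto intro!: poly_funs_sum poly_funs.mult poly_funs.const poly_funs_power\<close>)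
    then show ?thesis using indep1[of "\<lambda>i j. c i j k"] that by blast
  qed
  then show False using c by blast
qed

section \<open>Directional derivatives\<close>

text \<open>The chain rule along a line. The induction proves that some coefficients \<open>D\<close> represent all
  directional derivatives; the coordinate directions identify them with the partial derivatives.\<close>

lemma poly_funs_directional_derivative:
  assumes "f \<in> poly_funs"
  shows "((\<lambda>t. f (q + t *s v)) has_field_derivative
    (\<Sum>i\<in>UNIV. partial_deriv i f q * v $ i)) (at 0)"
proof -
  have "\<exists>D. \<forall>v. ((\<lambda>t. f (q + t *s v)) has_field_derivative (\<Sum>i\<in>UNIV. D i * v $ i)) (at 0)"
    using assms
  proof induction
    case (const c)
    show ?case by (rule exI[of _ "\<lambda>_. 0"]) simp
  next
    case (coord i)
    have "(\<Sum>j\<in>UNIV. (if j = i then 1 else 0) * v $ j) = v $ i" for v :: "complex ^ 'a"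
      by (simp add: if_distrib[of "\<lambda>x. x * _"] cong: if_cong)
    then show ?case
      by (intro exI[of _ "\<lambda>j. if j = i then 1 else 0"]) (auto intro!: derivative_eq_intros)
  next
    case (add f g)
    then obtain D E where
      "\<forall>v. ((\<lambda>t. f (q + t *s v)) has_field_derivative (\<Sum>i\<in>UNIV. D i * v $ i)) (at 0)"
      "\<forall>v. ((\<lambda>t. g (q + t *s v)) has_field_derivative (\<Sum>i\<in>UNIV. E i * v $ i)) (at 0)"
      by blast
    then show ?case
      by (intro exI[of _ "\<lambda>i. D i + E i"])
        (auto simp: distrib_right sum.distrib intro!: DERIV_add)
  next
    case (mult f g)
    then obtain D E where DE:
      "\<And>v. ((\<lambda>t. f (q + t *s v)) has_field_derivative (\<Sum>i\<in>UNIV. D i * v $ i)) (at 0)"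
      "\<And>v. ((\<lambda>t. g (q + t *s v)) has_field_derivative (\<Sum>i\<in>UNIV. E i * v $ i)) (at 0)"
      by blast
    have "(\<Sum>i\<in>UNIV. (D i * g q + E i * f q) * v $ i)
      = (\<Sum>i\<in>UNIV. D i * v $ i) * g q + (\<Sum>i\<in>UNIV. E i * v $ i) * f q" for v
      unfolding sum_distrib_right sum.distrib[symmetric]
      by (intro sum.cong refl) (simp add: algebra_simps)
    then show ?case
      using DERIV_mult[OF DE(1) DE(2)] by (intro exI[of _ "\<lambda>i. D i * g q + E i * f q"]) simp
  qed
  then obtain D where D:
    "\<And>v. ((\<lambda>t. f (q + t *s v)) has_field_derivative (\<Sum>i\<in>UNIV. D i * v $ i)) (at 0)"
    by blast
  have "partial_deriv i f q = D i" for i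
  proof -
    have "(\<Sum>j\<in>UNIV. D j * axis i 1 $ j) = D i"
      by (simp add: axis_def if_distrib[of "\<lambda>x. _ * x"] cong: if_cong)
    with D[of "axis i 1"]
    have "((\<lambda>t. f (q + t *s axis i 1)) has_field_derivative D i) (at (q $ i - q $ i))"
      by simp
    then have "((\<lambda>t. f (q + (t - q $ i) *s axis i 1)) has_field_derivative D i) (at (q $ i))"
      using DERIV_shift[of "\<lambda>t. f (q + t *s axis i 1)" "D i" "q $ i" "- (q $ i)"] by simp
    moreover have "q + (t - q $ i) *s axis i 1 = (\<chi> j. if j = i then t else q $ j)" for t
      by (simp add: vec_eq_iff axis_def)
    ultimately show ?thesis unfolding partial_deriv_def by (simp add: DERIV_imp_deriv)
  qed
  then show ?thesis using D by simp
qed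

section \<open>The hypothesis variety as a union of planes\<close>

definition two_valued_vec :: "'n set \<Rightarrow> 'a \<Rightarrow> 'a \<Rightarrow> 'a ^ 'n" where
  "two_valued_vec T a b = (\<chi> i. if i \<in> T then a else b)"

lemma two_valued_vec_nth [simp]: "two_valued_vec T a b $ i = (if i \<in> T then a else b)"
  by (simp add: two_valued_vec_def)

lemma two_valued_vec_add_scale:
  "two_valued_vec T a b + t *s two_valued_vec T c d
    = two_valued_vec T (a + t * c) (b + (t :: complex) * d)"
  by (simp add: vec_eq_iff)

text \<open>The roots of \<open>(y - \<beta>\<^sub>1)\<^sup>2 = \<beta>\<^sub>0\<close> are at most two, and any \<open>a\<close>, \<open>b\<close> are the roots for
  \<open>\<beta>\<^sub>1 = (a + b) / 2\<close> and \<open>\<beta>\<^sub>0 = ((a - b) / 2)\<^sup>2\<close>.\<close>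

lemma image_incidence_variety:
  "fst ` incidence_variety
    = {x :: complex ^ 'm. \<forall>i j k. (x $ i - x $ j) * (x $ j - x $ k) * (x $ i - x $ k) = 0}"
  (is "?I = ?V")
proof
  show "?I \<subseteq> ?V"
  proof
    fix x :: "complex ^ 'm" assume "x \<in> ?I"
    then obtain c b where "\<forall>i. sphere0 (c, b) (x $ i) = 0"
      unfolding incidence_variety_def by fastforce
    then have cb: "(x $ i - b)\<^sup>2 = c" for i by (simp add: sphere0_def)
    have "x $ i = x $ j \<or> x $ i - b = - (x $ j - b)" for i j
      using cb[of i] cb[of j] power2_eq_iff[of "x $ i - b" "x $ j - b"] by auto
    then have "x $ i = x $ j \<or> x $ j = x $ k \<or> x $ i = x $ k" for i j k
      by (metis diff_add_cancel minus_equation_iff)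
    then show "x \<in> ?V" by auto
  qed
next
  show "?V \<subseteq> ?I"
  proof
    fix x :: "complex ^ 'm" assume x: "x \<in> ?V"
    have "\<exists>a b. \<forall>i. x $ i = a \<or> x $ i = b"
    proof (cases "\<exists>i j. x $ i \<noteq> x $ j")
      case True
      then obtain i j where "x $ i \<noteq> x $ j" by blast
      moreover from this have "x $ k = x $ i \<or> x $ k = x $ j" for k using x by auto
      ultimately show ?thesis by blast
    qed blast
    then obtain a b where ab: "\<And>i. x $ i = a \<or> x $ i = b" by blast
    have "sphere0 (((a - b) / 2)\<^sup>2, (a + b) / 2) (x $ i) = 0" for i
      using ab[of i] by (auto simp: sphere0_def power2_eq_square field_simps)
    then show "x \<in> ?I" unfolding incidence_variety_def by force
  qed
qed

lemma hypothesis_variety_eq: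
  "(hypothesis_variety :: (complex ^ 'm) set)
    = {x. \<forall>i j k. (x $ i - x $ j) * (x $ j - x $ k) * (x $ i - x $ k) = 0}"
proof -
  let ?S = "range (\<lambda>(i, j, k) (x :: complex ^ 'm).
    (x $ i - x $ j) * (x $ j - x $ k) * (x $ i - x $ k))"
  have "?S \<subseteq> poly_funs"
    by (auto intro!: poly_funs.mult poly_funs_diff poly_funs.coord)
  then have "zariski_closed (fst ` incidence_variety :: (complex ^ 'm) set)"
    unfolding zariski_closed_def image_incidence_variety by (intro exI[of _ ?S]) auto
  then show ?thesis
    unfolding hypothesis_variety_def image_incidence_variety[symmetric] by (rule hull_same)
qed

lemma two_valued_vec_in_hypothesis_variety: "two_valued_vec T a b \<in> hypothesis_variety"
  by (auto simp: hypothesis_variety_eq)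

lemma hypothesis_variety_two_valued_vec:
  assumes "x \<in> hypothesis_variety"
  shows "\<exists>a. x = two_valued_vec {i. x $ i \<noteq> x $ i0} a (x $ i0)"
proof (cases "\<exists>j. x $ j \<noteq> x $ i0")
  case True
  then obtain j where "x $ j \<noteq> x $ i0" by blast
  then have "x = two_valued_vec {i. x $ i \<noteq> x $ i0} (x $ j) (x $ i0)"
    using assms unfolding hypothesis_variety_eq vec_eq_iff by auto
  then show ?thesis ..
next
  case False
  then show ?thesis by (auto simp: vec_eq_iff)
qed

text \<open>Since the vanishing ideal of \<open>Z\<close> is prime, each cubic equation of the hypothesis variety has a
  linear factor that vanishes on all of \<open>Z\<close>. So coordinates that are not identically equal to
  a given one on \<open>Z\<close> are identically equal to each other.\<close>

lemma irreducible_subset_of_plane: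
  assumes Z: "irreducible_variety Z" and sub: "Z \<subseteq> hypothesis_variety"
  shows "\<exists>T. Z \<subseteq> {two_valued_vec T a b | a b. True}"
proof -
  fix i0 :: 'a
  define T where "T = {i. \<exists>x\<in>Z. x $ i \<noteq> x $ i0}"
  have on_T: "x $ i = x $ j" if ij: "i \<in> T" "j \<in> T" and x: "x \<in> Z" for i j x
  proof -
    let ?d = "\<lambda>i j x :: complex ^ 'a. x $ i - x $ j"
    have d: "?d i j \<in> poly_funs" for i j by (intro poly_funs_diff poly_funs.coord)
    have "?d i j x * ?d j i0 x * ?d i i0 x = 0" if "x \<in> Z" for x
      using sub that unfolding hypothesis_variety_eq by blast
    then have "(\<forall>x\<in>Z. ?d i j x * ?d j i0 x = 0) \<or> (\<forall>x\<in>Z. ?d i i0 x = 0)"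
      by (intro irreducible_variety_prime[OF Z] poly_funs.mult d)
    then have "(\<forall>x\<in>Z. ?d i j x = 0) \<or> (\<forall>x\<in>Z. ?d j i0 x = 0) \<or> (\<forall>x\<in>Z. ?d i i0 x = 0)"
      using irreducible_variety_prime[OF Z d d] by blast
    then show ?thesis using ij x by (auto simp: T_def)
  qed
  \<comment> \<open>If \<open>T\<close> is empty, then the first value is arbitrary.\<close>
  have "x = two_valued_vec T (x $ (SOME i. i \<in> T)) (x $ i0)" if "x \<in> Z" for x
  proof -
    have "x $ i = x $ (SOME i. i \<in> T)" if "i \<in> T" for i
      using on_T[OF that someI[of "\<lambda>i. i \<in> T", OF that] \<open>x \<in> Z\<close>] .
    moreover have "x $ i = x $ i0" if "i \<notin> T" for i using that \<open>x \<in> Z\<close> by (auto simp: T_def)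
    ultimately show ?thesis unfolding vec_eq_iff two_valued_vec_nth by metis
  qed
  then show ?thesis by blast
qed

section \<open>Nonsingular points and tangent spaces\<close>

text \<open>A function that vanishes on the variety is constant along the lines in the plane of \<open>T\<close>. Here
  \<open>a = b\<close> is allowed: at a constant vector the tangent space contains all of the planes.\<close>

lemma two_valued_vec_in_tangent_space:
  "two_valued_vec T c d \<in> tangent_space hypothesis_variety (two_valued_vec T a b)"
proof -
  let ?q = "two_valued_vec T a b" and ?v = "two_valued_vec T c d"
  have "(\<Sum>i\<in>UNIV. partial_deriv i f ?q * ?v $ i) = 0" if "f \<in> vanishing_ideal hypothesis_variety"
    for f
  proof (rule DERIV_unique)
    show "((\<lambda>t. f (?q + t *s ?v)) has_field_derivative
        (\<Sum>i\<in>UNIV. partial_deriv i f ?q * ?v $ i)) (at 0)"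
      using that by (intro poly_funs_directional_derivative) (simp add: vanishing_ideal_def)
    have "(\<lambda>t. f (?q + t *s ?v)) = (\<lambda>t. 0)"
      using that two_valued_vec_in_hypothesis_variety[of T]
      by (simp add: vanishing_ideal_def two_valued_vec_add_scale fun_eq_iff)
    then show "((\<lambda>t. f (?q + t *s ?v)) has_field_derivative 0) (at 0)" by simp
  qed
  then show ?thesis by (simp add: tangent_space_def)
qed

text \<open>The equation \<open>(x\<^sub>i - x\<^sub>j) (x\<^sub>j - x\<^sub>k) (x\<^sub>i - x\<^sub>k) = 0\<close> has the nonzero differential
  \<open>(q\<^sub>i - q\<^sub>k)\<^sup>2 (dx\<^sub>i - dx\<^sub>j)\<close> at \<open>q\<close>.\<close>

lemma tangent_vector_equal_coordinates:
  assumes v: "v \<in> tangent_space hypothesis_variety q"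
    and q: "q $ i = q $ j" "q $ i \<noteq> q $ k"
  shows "v $ i = v $ j"
proof -
  define f :: "complex ^ 'a \<Rightarrow> complex"
    where "f x = (x $ i - x $ j) * (x $ j - x $ k) * (x $ i - x $ k)" for x
  have f: "f \<in> poly_funs"
    unfolding f_def by (intro poly_funs.mult poly_funs_diff poly_funs.coord)
  then have "f \<in> vanishing_ideal hypothesis_variety"
    by (auto simp: vanishing_ideal_def f_def hypothesis_variety_eq)
  then have "((\<lambda>t. f (q + t *s v)) has_field_derivative 0) (at 0)"
    using poly_funs_directional_derivative[OF f, of q v] v by (simp add: tangent_space_def)
  moreover have "((\<lambda>t. f (q + t *s v)) has_field_derivative
      (v $ i - v $ j) * (q $ i - q $ k)\<^sup>2) (at 0)"
    unfolding f_def using q(1)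
    by (auto intro!: derivative_eq_intros simp: power2_eq_square)
  ultimately have "(v $ i - v $ j) * (q $ i - q $ k)\<^sup>2 = 0" by (rule DERIV_unique[symmetric])
  then show ?thesis using q(2) by simp
qed

lemma tangent_space_two_valued_vec:
  assumes "a \<noteq> b" "T \<noteq> {}" "T \<noteq> UNIV"
  shows "tangent_space hypothesis_variety (two_valued_vec T a b)
    = {two_valued_vec T c d | c d. True}"
proof
  show "{two_valued_vec T c d | c d. True}
    \<subseteq> tangent_space hypothesis_variety (two_valued_vec T a b)"
    using two_valued_vec_in_tangent_space by blast
  obtain i j where ij: "i \<in> T" "j \<notin> T" using assms by blast
  show "tangent_space hypothesis_variety (two_valued_vec T a b)
    \<subseteq> {two_valued_vec T c d | c d. True}"
  proof
    fix v assume v: "v \<in> tangent_space hypothesis_variety (two_valued_vec T a b)"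
    have "v $ k = v $ i" if "k \<in> T" for k
      using tangent_vector_equal_coordinates[OF v, of k i j] that ij assms(1) by simp
    moreover have "v $ k = v $ j" if "k \<notin> T" for k
      using tangent_vector_equal_coordinates[OF v, of k j i] that ij assms(1) by simp
    ultimately have "v = two_valued_vec T (v $ i) (v $ j)" by (simp add: vec_eq_iff)
    then show "v \<in> {two_valued_vec T c d | c d. True}" by blast
  qed
qed

lemma two_valued_vec_eq_scaled_sum:
  "two_valued_vec T a b = a *s two_valued_vec T 1 0 + b *s two_valued_vec T 0 (1 :: complex)"
  by (simp add: vec_eq_iff)

lemma dim_two_valued_vecs:
  assumes "T \<noteq> {}" "T \<noteq> (UNIV :: 'n :: finite set)"
  shows "vec.dim {two_valued_vec T c d | c d :: complex. True} = 2"
proof -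
  obtain i j where ij: "i \<in> T" "j \<notin> T" using assms by blast
  let ?u = "two_valued_vec T 1 0 :: complex ^ 'n" and ?w = "two_valued_vec T 0 1 :: complex ^ 'n"
  have ne: "?u \<noteq> ?w" using ij(1) by (auto simp: vec_eq_iff)
  have "?w \<noteq> 0" using ij(2) by (auto simp: vec_eq_iff)
  moreover have "?u \<noteq> k *s ?w" for k
  proof
    assume "?u = k *s ?w"
    then have "?u $ i = (k *s ?w) $ i" by simp
    then show False using ij(1) by simp
  qed
  then have "?u \<notin> vec.span {?w}" by (auto simp: vec.span_singleton)
  ultimately have "vec.independent {?u, ?w}" using ne by (simp add: vec.independent_insert)
  moreover have "vec.span {?u, ?w} = {two_valued_vec T c d | c d. True}"
  proof (intro set_eqI iffI)
    fix x assume "x \<in> vec.span {?u, ?w}"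
    then obtain k l where "x - k *s ?u = l *s ?w"
      unfolding vec.span_insert[of ?u] vec.span_singleton by blast
    then have "x = two_valued_vec T k l"
      unfolding two_valued_vec_eq_scaled_sum[of T k l] by (simp add: diff_eq_eq add.commute)
    then show "x \<in> {two_valued_vec T c d | c d. True}" by blast
  next
    fix x :: "complex ^ 'n" assume "x \<in> {two_valued_vec T c d | c d. True}"
    then obtain c d where "x = c *s ?u + d *s ?w"
      using two_valued_vec_eq_scaled_sum[of T] by blast
    then show "x \<in> vec.span {?u, ?w}"
      by (simp add: vec.span_add vec.span_scale vec.span_base)
  qed
  ultimately show ?thesis
    using vec.dim_eq_card_independent[of "{?u, ?w}"] ne vec.dim_span[of "{?u, ?w}"] by simp
qed

text \<open>An irreducible subvariety of a union of planes lies in one of them, so a chain of four such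
  subvarieties would be a chain in a plane.\<close>

lemma local_dim_hypothesis_variety_le:
  fixes q :: "complex ^ 'n :: finite"
  shows "local_dim hypothesis_variety q \<le> 2"
  unfolding local_dim_def
proof (rule Sup_least)
  fix e assume "e \<in> {enat d | d. \<exists>Z. (\<forall>i\<le>d. irreducible_variety (Z i) \<and> q \<in> Z i \<and>
    Z i \<subseteq> hypothesis_variety) \<and> (\<forall>i<d. Z i \<subset> Z (Suc i))}"
  then obtain d and Z :: "nat \<Rightarrow> (complex ^ 'n) set" where d: "e = enat d"
    and Z: "\<And>i. i \<le> d \<Longrightarrow> irreducible_variety (Z i)" "\<And>i. i \<le> d \<Longrightarrow> Z i \<subseteq> hypothesis_variety"
    "\<And>i. i < d \<Longrightarrow> Z i \<subset> Z (Suc i)"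
    by (elim CollectE exE conjE) auto
  have "\<not> 3 \<le> d"
  proof
    assume "3 \<le> d"
    then obtain S where "Z 3 \<subseteq> {two_valued_vec S a b | a b. True}"
      using irreducible_subset_of_plane Z(1,2) by blast
    then have "Z 3 \<subseteq> {s *s two_valued_vec S 1 0 + t *s two_valued_vec S 0 1 | s t. True}"
      unfolding two_valued_vec_eq_scaled_sum[of S, symmetric] .
    then show False using Z(1,3) \<open>3 \<le> d\<close> by (intro no_long_chain_in_plane[of Z]) auto
  qed
  then show "e \<le> 2" using d by (simp add: numeral_eq_enat)
qed

text \<open>The chain consists of the point, the line through it in the direction of the all-ones
  vector, and the plane. The line is proper in the plane because it misses the origin.\<close>

lemma local_dim_hypothesis_variety_ge:
  fixes T :: "'n :: finite set"
  assumes "a \<noteq> b" "T \<noteq> {}" "T \<noteq> UNIV"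
  shows "enat 2 \<le> local_dim hypothesis_variety (two_valued_vec T a b)"
  unfolding local_dim_def
proof (rule Sup_upper, rule CollectI, intro exI conjI)
  let ?q = "two_valued_vec T a b"
  define Z :: "nat \<Rightarrow> (complex ^ 'n) set" where "Z i = (if i = 0 then {?q} else if i = (1 :: nat)
    then {two_valued_vec T (a + t) (b + t) | t. True} else {two_valued_vec T c d | c d. True})" for i
  obtain i0 j0 where ij: "i0 \<in> T" "j0 \<notin> T" using assms by blast
  have Z1: "Z 1 = {x. \<forall>i j. x $ i - x $ j - (?q $ i - ?q $ j) = 0}"
  proof (intro set_eqI iffI CollectI allI)
    fix x :: "complex ^ 'n" assume "x \<in> {x. \<forall>i j. x $ i - x $ j - (?q $ i - ?q $ j) = 0}"
    then have "\<forall>i j. x $ i - x $ j - (?q $ i - ?q $ j) = 0" by (rule CollectD)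
    then have difference: "x $ i - x $ i0 - (?q $ i - ?q $ i0) = 0" for i by (elim allE)
    have "x $ i = two_valued_vec T (a + (x $ i0 - a)) (b + (x $ i0 - a)) $ i" for i
    proof (cases "i \<in> T")
      case True
      then have "x $ i - x $ i0 - (a - a) = 0" using difference[of i] ij(1) by simp
      then show ?thesis unfolding two_valued_vec_nth if_P[OF True] by algebra
    next
      case False
      then have "x $ i - x $ i0 - (b - a) = 0" using difference[of i] ij(1) by simp
      then show ?thesis unfolding two_valued_vec_nth if_not_P[OF False] by algebra
    qed
    then have "\<exists>t. x = two_valued_vec T (a + t) (b + t)" unfolding vec_eq_iff by blast
    then show "x \<in> Z 1" by (simp add: Z_def)
  qed (auto simp: Z_def)
  \<comment> \<open>The factor restricts the equations to pairs in the same block.\<close>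
  have Z2: "Z 2 = {x. \<forall>i j. (if (i \<in> T) = (j \<in> T) then 1 else 0) * (x $ i - x $ j) = 0}"
  proof (intro set_eqI iffI CollectI allI)
    fix x :: "complex ^ 'n"
    assume "x \<in> {x. \<forall>i j. (if (i \<in> T) = (j \<in> T) then 1 else 0) * (x $ i - x $ j) = 0}"
    then have eq: "(if (i \<in> T) = (j \<in> T) then 1 else 0) * (x $ i - x $ j) = 0" for i j
      by blast
    have "x $ i = two_valued_vec T (x $ i0) (x $ j0) $ i" for i
      using eq[of i i0] eq[of i j0] ij by (cases "i \<in> T") auto
    then have "x = two_valued_vec T (x $ i0) (x $ j0)" unfolding vec_eq_iff by blast
    then show "x \<in> Z 2" unfolding Z_def by auto
  qed (auto simp: Z_def)
  have closed: "zariski_closed {x. \<forall>i j. F i j x = 0}" if "\<And>i j. F i j \<in> poly_funs"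
    for F :: "'n \<Rightarrow> 'n \<Rightarrow> complex ^ 'n \<Rightarrow> complex"
    unfolding zariski_closed_def using that
    by (intro exI[of _ "range (\<lambda>(i, j). F i j)"]) auto
  have "Z 0 = {x. \<forall>i j :: 'n. x $ i - ?q $ i = 0}" by (auto simp: Z_def vec_eq_iff)
  then have "zariski_closed (Z 0)"
    by (simp only:) (intro closed poly_funs_diff poly_funs.coord poly_funs.const)
  have "zariski_closed (Z 1)"
    unfolding Z1 by (intro closed poly_funs_diff poly_funs.coord poly_funs.const)
  have "zariski_closed (Z 2)"
    unfolding Z2 by (intro closed poly_funs_diff poly_funs.mult poly_funs.coord poly_funs.const)
  have closed_Z: "zariski_closed (Z i)" if "i \<le> 2" for i
  proof -
    have "i = 0 \<or> i = 1 \<or> i = 2" using that by linarith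
    then show ?thesis
      using \<open>zariski_closed (Z 0)\<close> \<open>zariski_closed (Z 1)\<close> \<open>zariski_closed (Z 2)\<close> by blast
  qed
  have "\<exists>t. ?q = two_valued_vec T (a + t) (b + t)" by (rule exI[of _ 0]) simp
  then have q_Z: "?q \<in> Z i" for i by (auto simp: Z_def)
  show "\<forall>i\<le>2. irreducible_variety (Z i) \<and> ?q \<in> Z i \<and> Z i \<subseteq> hypothesis_variety"
  proof (intro allI impI conjI q_Z)
    fix i :: nat assume i: "i \<le> 2"
    show "irreducible_variety (Z i)"
    proof (rule irreducible_variety_if_contains_lines[OF closed_Z[OF i]])
      show "Z i \<noteq> {}" using q_Z by blast
      fix x y t assume xy: "x \<in> Z i" "y \<in> Z i"
      have diff: "two_valued_vec T c d - two_valued_vec T c' d'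
        = two_valued_vec T (c - c') (d - d')" for c d c' d' :: complex
        by (simp add: vec_eq_iff)
      consider "i = 0" | "i = 1" | "i = 2" using i by linarith
      then show "x + t *s (y - x) \<in> Z i"
      proof cases
        case 1
        then show ?thesis using xy by (simp add: Z_def)
      next
        case 2
        then obtain r s where rs: "x = two_valued_vec T (a + r) (b + r)"
          "y = two_valued_vec T (a + s) (b + s)" using xy by (auto simp: Z_def)
        have "x + t *s (y - x) = two_valued_vec T (a + (r + t * (s - r))) (b + (r + t * (s - r)))"
          unfolding rs diff two_valued_vec_add_scale by (simp add: algebra_simps)
        then show ?thesis using 2 by (auto simp: Z_def)
      next
        case 3
        then obtain c d c' d' where "x = two_valued_vec T c d" "y = two_valued_vec T c' d'"
          using xy by (auto simp: Z_def)
        then have "x + t *s (y - x) = two_valued_vec T (c + t * (c' - c)) (d + t * (d' - d))"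
          by (simp only: diff two_valued_vec_add_scale)
        then show ?thesis using 3 by (auto simp: Z_def)
      qed
    qed
    show "Z i \<subseteq> hypothesis_variety"
      using two_valued_vec_in_hypothesis_variety by (auto simp: Z_def)
  qed
  have "two_valued_vec T (a + 1) (b + 1) \<in> Z 1" "two_valued_vec T (a + 1) (b + 1) \<notin> Z 0"
    using ij(1) by (auto simp: Z_def vec_eq_iff)
  moreover have "0 \<in> Z 2" "0 \<notin> Z 1"
  proof -
    have "0 = two_valued_vec T 0 (0 :: complex)" by (simp add: vec_eq_iff)
    then show "0 \<in> Z 2" unfolding Z_def by auto
    have "(0 :: complex ^ 'n) $ i0 - 0 $ j0 - (?q $ i0 - ?q $ j0) \<noteq> 0" using ij assms(1) by simp
    then show "0 \<notin> Z 1" unfolding Z1 by blast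
  qed
  moreover have "Z 0 \<subseteq> Z 1" using q_Z[of 1] by (simp add: Z_def[of 0])
  moreover have "Z 1 \<subseteq> Z 2" by (auto simp: Z_def)
  ultimately have "Z 0 \<subset> Z 1" "Z 1 \<subset> Z 2" by blast+
  then show "\<forall>i<2. Z i \<subset> Z (Suc i)" by (simp add: numeral_2_eq_2 All_less_Suc)
qed simp

section \<open>Critical points are given by block means\<close>

definition mean_on :: "'n set \<Rightarrow> complex ^ 'n \<Rightarrow> complex" where
  "mean_on S p = (\<Sum>i\<in>S. p $ i) / of_nat (card S)"

lemma sum_deviations_eq_0_iff:
  fixes S :: "'n :: finite set"
  assumes "S \<noteq> {}"
  shows "(\<Sum>i\<in>S. p $ i - c) = 0 \<longleftrightarrow> c = mean_on S p"
  using assms by (auto simp: mean_on_def sum_subtractf field_simps)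

lemma bilin_two_valued_vec:
  "bilin (p - two_valued_vec T a b) (two_valued_vec T c d)
    = c * (\<Sum>i\<in>T. p $ i - a) + d * (\<Sum>i\<in>- T. p $ i - b)"
proof -
  have "bilin (p - two_valued_vec T a b) (two_valued_vec T c d)
    = (\<Sum>i\<in>UNIV. if i \<in> T then c * (p $ i - a) else d * (p $ i - b))"
    unfolding bilin_def by (intro sum.cong) auto
  also have "\<dots> = (\<Sum>i\<in>T. c * (p $ i - a)) + (\<Sum>i\<in>- T. d * (p $ i - b))"
    by (simp add: sum.If_cases Compl_eq)
  finally show ?thesis by (simp add: sum_distrib_left)
qed

text \<open>The vector \<open>p - q\<close> is orthogonal to the indicator vectors of both blocks.\<close>

lemma critical_point_block_means:
  assumes crit: "two_valued_vec T a b \<in> critical_points hypothesis_variety p"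
    and T: "T \<noteq> {}" "T \<noteq> UNIV"
  shows "a = mean_on T p" "b = mean_on (- T) p"
proof -
  have "bilin (p - two_valued_vec T a b) (two_valued_vec T c d) = 0" for c d
    using crit two_valued_vec_in_tangent_space unfolding critical_points_def by blast
  note orth = this[unfolded bilin_two_valued_vec]
  have "- T \<noteq> {}" using T by blast
  then show "a = mean_on T p" "b = mean_on (- T) p"
    using orth[of 1 0] orth[of 0 1] T(1) by (simp_all add: sum_deviations_eq_0_iff)
qed

text \<open>Different means make the projection a nonconstant vector. There the variety is locally a plane,
  so its dimension and its tangent space are those of the plane.\<close>

lemma block_means_critical_point:
  assumes "mean_on T p \<noteq> mean_on (- T) p" and T: "T \<noteq> {}" "T \<noteq> UNIV"
  shows "two_valued_vec T (mean_on T p) (mean_on (- T) p) \<in> critical_points hypothesis_variety p"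
    (is "?q \<in> _")
proof -
  have tangent: "tangent_space hypothesis_variety ?q = {two_valued_vec T c d | c d. True}"
    by (rule tangent_space_two_valued_vec[OF assms])
  then have "nonsingular_point hypothesis_variety ?q"
    unfolding nonsingular_point_def
    using local_dim_hypothesis_variety_le[of ?q] local_dim_hypothesis_variety_ge[OF assms]
      dim_two_valued_vecs[OF T]
      two_valued_vec_in_hypothesis_variety by (simp add: numeral_eq_enat)
  moreover have "- T \<noteq> {}" using T by blast
  have "bilin (p - ?q) v = 0" if "v \<in> tangent_space hypothesis_variety ?q" for v
  proof -
    have "(\<Sum>i\<in>T. p $ i - mean_on T p) = 0" "(\<Sum>i\<in>- T. p $ i - mean_on (- T) p) = 0"
      using T(1) sum_deviations_eq_0_iff[of "- T"] \<open>- T \<noteq> {}\<close>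
      by (simp_all add: sum_deviations_eq_0_iff)
    then show ?thesis using that tangent by (auto simp: bilin_two_valued_vec)
  qed
  ultimately show ?thesis by (simp add: critical_points_def)
qed

text \<open>Each partition into two nonempty blocks has exactly one block that avoids a given \<open>i0\<close>. This
  picks one of the two sets \<open>T\<close> and \<open>- T\<close>, which describe the same plane.\<close>

definition blocks_avoiding :: "'n \<Rightarrow> 'n set set" where
  "blocks_avoiding i0 = Pow (- {i0}) - {{}}"

lemma card_blocks_avoiding: "card (blocks_avoiding (i0 :: 'n :: finite)) = 2 ^ (CARD('n) - 1) - 1"
  by (simp add: blocks_avoiding_def card_Diff_subset card_Pow Compl_eq_Diff_UNIV)

lemma blocks_avoidingD:
  assumes "T \<in> blocks_avoiding i0"
  shows "T \<noteq> {}" "T \<noteq> UNIV" "i0 \<notin> T"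
  using assms by (auto simp: blocks_avoiding_def)

text \<open>For a constant vector any block will do; one exists as there are at least two coordinates.\<close>

lemma hypothesis_variety_block:
  assumes "q \<in> (hypothesis_variety :: (complex ^ 'm) set)" "CARD('m :: finite) \<ge> 2"
  shows "\<exists>T\<in>blocks_avoiding i0. \<exists>a b. q = two_valued_vec T a b"
proof -
  obtain a where a: "q = two_valued_vec {i. q $ i \<noteq> q $ i0} a (q $ i0)"
    using hypothesis_variety_two_valued_vec[OF assms(1)] by blast
  show ?thesis
  proof (cases "{i. q $ i \<noteq> q $ i0} = {}")
    case False
    then have "{i. q $ i \<noteq> q $ i0} \<in> blocks_avoiding i0" by (auto simp: blocks_avoiding_def)
    then show ?thesis using a by blast
  next
    case True
    have "card (- {i0}) > 0" using assms(2) by (simp add: Compl_eq_Diff_UNIV)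
    then have "- {i0} \<in> blocks_avoiding i0"
      unfolding blocks_avoiding_def by (metis DiffI Pow_top card.empty less_irrefl singletonD)
    moreover have "q = two_valued_vec (- {i0}) (q $ i0) (q $ i0)"
      using True by (auto simp: vec_eq_iff)
    ultimately show ?thesis by blast
  qed
qed

lemma poly_funs_mean_on: "mean_on S \<in> poly_funs"
proof -
  have "mean_on S = (\<lambda>p. (\<Sum>i\<in>S. p $ i) * (1 / of_nat (card S)))"
    by (simp add: mean_on_def fun_eq_iff)
  then show ?thesis
    by (simp only:) (intro poly_funs.mult poly_funs_sum poly_funs.coord poly_funs.const)
qed

text \<open>A point is generic if its means over \<open>T\<close> and \<open>- T\<close> differ for every block \<open>T\<close>. This is the
  nonvanishing of a product of linear forms, and a coordinate vector satisfies it.\<close>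

lemma has_ED_degree_hypothesis_variety:
  assumes m: "CARD('m :: finite) \<ge> 2"
  shows "has_ED_degree (hypothesis_variety :: (complex ^ 'm) set) (2 ^ (CARD('m) - 1) - 1)"
proof -
  fix i0 :: 'm
  let ?B = "blocks_avoiding i0"
  define U where "U = {p :: complex ^ 'm. \<forall>T\<in>?B. mean_on T p \<noteq> mean_on (- T) p}"
  define proj where "proj p T = two_valued_vec T (mean_on T p) (mean_on (- T) p)"
    for p :: "complex ^ 'm" and T
  let ?f = "\<lambda>p :: complex ^ 'm. \<Prod>T\<in>?B. mean_on T p - mean_on (- T) p"
  have f: "?f \<in> poly_funs" by (intro poly_funs_prod poly_funs_diff poly_funs_mean_on)
  have "finite ?B" by simp
  then have "- U = {p. \<forall>f\<in>{?f}. f p = 0}" by (simp add: U_def set_eq_iff)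
  then have "zariski_open U"
    unfolding zariski_open_def zariski_closed_def using f by (intro exI[of _ "{?f}"]) simp
  moreover have "U \<noteq> {}"
  proof -
    have "mean_on T (axis i0 1) \<noteq> mean_on (- T) (axis i0 1)" if "T \<in> ?B" for T
    proof -
      have i0: "i0 \<notin> T" by (rule blocks_avoidingD(3)[OF that])
      have "mean_on T (axis i0 1) = 0" using i0 by (auto simp: mean_on_def axis_def)
      moreover have "mean_on (- T) (axis i0 1) = 1 / of_nat (card (- T))"
        using i0 by (simp add: mean_on_def axis_def)
      moreover have "card (- T) \<noteq> 0" using i0 by auto
      ultimately show ?thesis by auto
    qed
    then have "axis i0 1 \<in> U" by (simp add: U_def)
    then show ?thesis by blast
  qed
  moreover have "finite (critical_points hypothesis_variety p) \<and>
      card (critical_points hypothesis_variety p) = 2 ^ (CARD('m) - 1) - 1" if p: "p \<in> U" for p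
  proof -
    have "critical_points hypothesis_variety p = proj p ` ?B"
    proof
      show "critical_points hypothesis_variety p \<subseteq> proj p ` ?B"
      proof
        fix q assume q: "q \<in> critical_points hypothesis_variety p"
        then have "q \<in> hypothesis_variety"
          by (simp add: critical_points_def nonsingular_point_def)
        then obtain T a b where T: "T \<in> ?B" "q = two_valued_vec T a b"
          using hypothesis_variety_block[OF _ m] by blast
        then show "q \<in> proj p ` ?B"
          using critical_point_block_means[of T a b p] q blocks_avoidingD[OF T(1)]
          by (auto simp: proj_def)
      qed
      show "proj p ` ?B \<subseteq> critical_points hypothesis_variety p"
        using p blocks_avoidingD(1,2)[of _ i0]
        by (auto simp: proj_def U_def intro!: block_means_critical_point)
    qed
    moreover have "inj_on (proj p) ?B"
    proof (rule inj_on_inverseI[of _ "\<lambda>q. {i. q $ i \<noteq> q $ i0}"])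
      fix T assume "T \<in> ?B"
      then show "{i. proj p T $ i \<noteq> proj p T $ i0} = T"
        using p blocks_avoidingD[of T i0] by (auto simp: proj_def U_def)
    qed
    ultimately show ?thesis using card_blocks_avoiding[of i0] by (simp add: card_image)
  qed
  ultimately show ?thesis unfolding has_ED_degree_def by blast
qed

lemma critical_points_real:
  fixes p :: "complex ^ 'm :: finite"
  assumes m: "CARD('m) \<ge> 2" and p: "\<And>i. p $ i \<in> \<real>"
    and q: "q \<in> critical_points hypothesis_variety p"
  shows "q $ i \<in> \<real>"
proof -
  have "q \<in> hypothesis_variety"
    using q by (simp add: critical_points_def nonsingular_point_def)
  then obtain T a b where T: "T \<in> blocks_avoiding i" "q = two_valued_vec T a b"
    using hypothesis_variety_block[OF _ m] by blast
  then have "b = mean_on (- T) p"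
    using critical_point_block_means[of T a b p] q blocks_avoidingD(1,2)[OF T(1)] by simp
  moreover have "mean_on S p \<in> \<real>" for S
    unfolding mean_on_def using p by (intro Reals_divide sum_in_Reals Reals_of_nat) auto
  ultimately show ?thesis using T blocks_avoidingD(3)[OF T(1)] by simp
qed

theorem theorem1:
  assumes "CARD('m::finite) \<ge> 2"
  shows "ED_degree (hypothesis_variety :: (complex ^ 'm) set) = 2 ^ (CARD('m) - 1) - 1
    \<and> (\<forall>p :: complex ^ 'm. (\<forall>i. p $ i \<in> \<real>) \<longrightarrow>
          (\<forall>q \<in> critical_points hypothesis_variety p. \<forall>i. q $ i \<in> \<real>))"
  using ED_degree_eqI[OF has_ED_degree_hypothesis_variety[OF assms]] critical_points_real[OF assms]
  by blast

end
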